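(* Let $H_1,H_2$ be real Hilbert spaces, $C:H_1\to H_2$ a bounded linear mapping with adjoint $C^T:H_2\to H_1$, and $\mathcal{M}_1:H_1\rightrightarrows H_1$, $\mathcal{M}_2:H_2\rightrightarrows H_2$ maximal monotone operators. Let $\lambda>0$ and $y\in H_1$ be given. Then $$J_{\lambda(\mathcal{M}_1+C^T\mathcal{M}_2C)}\,y=J_{\lambda\mathcal{M}_1}(y-\lambda C^Tu),$$ where $u$ is the fixed point of the operator $\mathcal{P}:H_2\to H_2$ defined by $$u\mapsto\mathcal{P}(u):=(\mathcal{M}_2)_\kappa\Big(C J_{\lambda\mathcal{M}_1}(y-\lambda C^Tu)+\kappa u\Big),$$ that is, for any $\kappa>0$, $$u=(\mathcal{M}_2)_\kappa\Big(C J_{\lambda\mathcal{M}_1}(y-\lambda C^Tu)+\kappa u\Big).$$ Furthermore, if $\frac{\lambda}{\kappa}\le\frac{2}{\|C\|^2}$, then $\|I-\frac{\lambda}{\kappa}CC^T\|\le1$, and thus $\mathcal{P}$ is nonexpansive.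
   Context: The composite $C^T\mathcal{M}_2C:H_1\rightrightarrows H_1$ is $C^T\mathcal{M}_2C(x)=\{C^Tu^*: u^*\in\mathcal{M}_2(Cx)\}$, and sums of set-valued operators are pointwise. The resolvent of an operator $\mathcal{A}$ is $J_{\mathcal{A}}=(I+\mathcal{A})^{-1}$, so $x=J_{\lambda(\mathcal{M}_1+C^T\mathcal{M}_2C)}\,y$ means that $x\in H_1$ satisfies $y\in x+\lambda\mathcal{M}_1x+\lambda C^T\mathcal{M}_2Cx$. The Yosida approximation of $\mathcal{M}_2$ of index $\kappa>0$ is $(\mathcal{M}_2)_\kappa=\frac1\kappa(I-J_{\kappa\mathcal{M}_2})=(\kappa I+\mathcal{M}_2^{-1})^{-1}$. Nonexpansive means Lipschitz with constant $1$. *)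

theory Defs
  imports "HOL-Analysis.Analysis"
begin

definition op_id :: "'a \<Rightarrow> 'a set" where
  "op_id x = {x}"

definition op_inverse :: "('a \<Rightarrow> 'b set) \<Rightarrow> 'b \<Rightarrow> 'a set" where
  "op_inverse A y = {x. y \<in> A x}"

definition op_sum :: "('a \<Rightarrow> 'b::real_vector set) \<Rightarrow> ('a \<Rightarrow> 'b set) \<Rightarrow> 'a \<Rightarrow> 'b set" where
  "op_sum A B x = {a + b | a b. a \<in> A x \<and> b \<in> B x}"

definition op_scale :: "real \<Rightarrow> ('a \<Rightarrow> 'b::real_vector set) \<Rightarrow> 'a \<Rightarrow> 'b set" where
  "op_scale c A x = (\<lambda>a. c *\<^sub>R a) ` A x"

definition adjoint_comp ::
    "('a::real_inner \<Rightarrow> 'b::real_inner) \<Rightarrow> ('b \<Rightarrow> 'b set) \<Rightarrow> 'a \<Rightarrow> 'a set" where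
  "adjoint_comp C M x = adjoint C ` M (C x)"

definition monotone_operator :: "('a::real_inner \<Rightarrow> 'a set) \<Rightarrow> bool" where
  "monotone_operator A \<longleftrightarrow>
     (\<forall>x y. \<forall>u \<in> A x. \<forall>v \<in> A y. (u - v) \<bullet> (x - y) \<ge> 0)"

definition maximal_monotone :: "('a::real_inner \<Rightarrow> 'a set) \<Rightarrow> bool" where
  "maximal_monotone A \<longleftrightarrow> monotone_operator A \<and>
     (\<forall>B. monotone_operator B \<and> (\<forall>x. A x \<subseteq> B x) \<longrightarrow> B = A)"

definition resolvent :: "('a::real_vector \<Rightarrow> 'a set) \<Rightarrow> 'a \<Rightarrow> 'a set" where
  "resolvent A = op_inverse (op_sum op_id A)"

text \<open>The resolvent as a point-valued map; it is meaningful only at points where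
  \<^term>\<open>resolvent A z\<close> is a singleton.\<close>

definition resolvent_fun :: "('a::real_vector \<Rightarrow> 'a set) \<Rightarrow> 'a \<Rightarrow> 'a" where
  "resolvent_fun A z = the_elem (resolvent A z)"

definition yosida :: "('a::real_vector \<Rightarrow> 'a set) \<Rightarrow> real \<Rightarrow> 'a \<Rightarrow> 'a" where
  "yosida A \<kappa> z = (1 / \<kappa>) *\<^sub>R (z - resolvent_fun (op_scale \<kappa> A) z)"

definition fixpoint_map ::
    "('a::real_inner \<Rightarrow> 'b::real_inner) \<Rightarrow> ('a \<Rightarrow> 'a set) \<Rightarrow> ('b \<Rightarrow> 'b set)
      \<Rightarrow> real \<Rightarrow> 'a \<Rightarrow> real \<Rightarrow> 'b \<Rightarrow> 'b" where
  "fixpoint_map C M1 M2 lam y \<kappa> u =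
     yosida M2 \<kappa>
       (C (resolvent_fun (op_scale lam M1) (y - lam *\<^sub>R adjoint C u)) + \<kappa> *\<^sub>R u)"

end

theory Submission
  imports Defs
begin

text \<open>
  The analytic core is a minimisation principle for a strongly convex function over a convex set
  (lemma \<open>convex_strongly_convex_minorant\<close>): if \<open>\<parallel>w\<parallel>\<^sup>2 + c\<close> is bounded below by \<open>m\<close> on a convex
  set of pairs \<open>(w, c)\<close>, then a minimising sequence is Cauchy in \<open>w\<close> by the parallelogram law,
  and the first-order optimality condition at its limit \<open>x\<close> says that the affine function
  \<open>2 (x \<bullet> w) + c - \<parallel>x\<parallel>\<^sup>2\<close>, which minorises \<open>\<parallel>w\<parallel>\<^sup>2 + c\<close>, is still bounded below by \<open>m\<close>.
  Two facts about Hilbert spaces follow from it.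

  Applied to the graph of a bounded linear functional it gives the Riesz representation, hence
  the existence of \<open>C\<^sup>T\<close>.  Applied to the convex hull of the pairs \<open>((a - v) / 2, v \<bullet> a)\<close>,
  with \<open>(a, v)\<close> in a monotone graph, it gives Minty's theorem.  There the lower bound \<open>m = 0\<close>
  comes from monotonicity, and the resulting \<open>x\<close> satisfies \<open>(v + x) \<bullet> (a - x) \<ge> 0\<close> on the whole
  graph, so that by maximality \<open>(x, -x)\<close> belongs to the graph.  Scaling and translating, the
  resolvents of maximal monotone operators are defined everywhere and point-valued.

  The fixed point equation then unfolds algebraically: with
  \<open>x = J\<^bsub>\<lambda> M1\<^esub> (y - \<lambda> C\<^sup>T u)\<close>, the equation \<open>u = (M2)\<^bsub>\<kappa>\<^esub> (C x + \<kappa> u)\<close> says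
  \<open>J\<^bsub>\<kappa> M2\<^esub> (C x + \<kappa> u) = C x\<close>, that is \<open>u \<in> M2 (C x)\<close>, whatever \<open>\<kappa> > 0\<close> is.  So a fixed point
  \<open>u\<close> is precisely an element of \<open>M2 (C x)\<close> witnessing \<open>y \<in> x + \<lambda> M1 x + \<lambda> C\<^sup>T (M2 (C x))\<close>,
  and \<open>x\<close> is the only point with such a witness because \<open>M1 + C\<^sup>T M2 C\<close> is monotone.

  Nonexpansiveness combines the Lipschitz constant \<open>1 / \<kappa>\<close> of the Yosida approximation
  with the firm nonexpansiveness of \<open>J\<^bsub>\<lambda> M1\<^esub>\<close>: if \<open>d\<close> is the increment of \<open>u\<close> and \<open>p\<close> that of \<open>x\<close>,
  then \<open>\<parallel>p\<parallel>\<^sup>2 \<le> - \<lambda> (C p \<bullet> d)\<close>, and this cross term in \<open>\<parallel>C p + \<kappa> d\<parallel>\<^sup>2\<close> absorbs \<open>\<parallel>C p\<parallel>\<^sup>2\<close>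
  as soon as \<open>(\<lambda> / \<kappa>) \<parallel>C\<parallel>\<^sup>2 \<le> 2\<close>.  The same cancellation bounds \<open>I - (\<lambda> / \<kappa>) C C\<^sup>T\<close>.
\<close>

section \<open>An affine minorant from a minimising sequence\<close>

text \<open>For nonempty \<open>K\<close>, the point \<open>x\<close> is the first component of a minimiser of \<open>\<parallel>w\<parallel>\<^sup>2 + c\<close> over
  the closure of \<open>K\<close>, and the conclusion is its optimality condition.  Stating it through
  the given bound \<open>m\<close> hides both the infimum and the closure.\<close>

lemma convex_strongly_convex_minorant:
  fixes K :: "('a::{real_inner,complete_space} \<times> real) set"
  assumes conv: "convex K"
    and bound: "\<And>w c. (w, c) \<in> K \<Longrightarrow> m \<le> (norm w)\<^sup>2 + c"
  shows "\<exists>x. \<forall>(w, c)\<in>K. (norm x)\<^sup>2 + m \<le> 2 * (x \<bullet> w) + c"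
proof (cases "K = {}")
  case False
  define h where "h = (\<lambda>(w::'a, c::real). (norm w)\<^sup>2 + c)"
  define i where "i = Inf (h ` K)"
  have bdd: "bdd_below (h ` K)"
    using bound by (intro bdd_belowI[of _ m]) (auto simp: h_def)
  have i_le: "i \<le> (norm w)\<^sup>2 + c" if "(w, c) \<in> K" for w c
    using cInf_lower[OF imageI[OF that] bdd] by (simp add: i_def h_def)
  have m_le: "m \<le> i"
    unfolding i_def using False bound by (intro cInf_greatest) (auto simp: h_def)
  have "\<exists>p\<in>K. h p < i + 1 / real (Suc n)" for n
    using cInf_less_iff[OF _ bdd, of "i + 1 / real (Suc n)"] False by (auto simp: i_def)
  then obtain p where pK: "\<And>n. p n \<in> K" and p_less: "\<And>n. h (p n) < i + 1 / real (Suc n)"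
    by metis
  define w where "w n = fst (p n)" for n
  define c where "c n = snd (p n)" for n
  have wcK: "(w n, c n) \<in> K" for n
    using pK by (simp add: w_def c_def)
  have wc_less: "(norm (w n))\<^sup>2 + c n < i + 1 / real (Suc n)" for n
    using p_less[of n] by (simp add: w_def c_def h_def split: prod.splits)
  \<comment> \<open>The midpoint of two almost minimisers is no better than the infimum, so the
    parallelogram law forces them to be close.\<close>
  have close: "(norm (w k - w n))\<^sup>2 \<le> 4 / real (Suc N)" if "N \<le> k" "N \<le> n" for N k n
  proof -
    have "(1/2) *\<^sub>R (w k, c k) + (1/2) *\<^sub>R (w n, c n) \<in> K"
      by (rule convexD[OF conv wcK wcK]) auto
    then have mid: "i \<le> (norm ((1/2) *\<^sub>R w k + (1/2) *\<^sub>R w n))\<^sup>2 + (c k + c n) / 2"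
      using i_le by (simp add: add_divide_distrib)
    have par: "(norm (w k - w n))\<^sup>2 =
        2 * (norm (w k))\<^sup>2 + 2 * (norm (w n))\<^sup>2 - 4 * (norm ((1/2) *\<^sub>R w k + (1/2) *\<^sub>R w n))\<^sup>2"
      unfolding power2_norm_eq_inner
      by (simp add: inner_commute algebra_simps)
    have "1 / real (Suc k) \<le> 1 / real (Suc N)" "1 / real (Suc n) \<le> 1 / real (Suc N)"
      using that by (auto simp: frac_le)
    with mid par wc_less[of k] wc_less[of n] show ?thesis
      by argo
  qed
  have "Cauchy w"
  proof (rule metric_CauchyI)
    fix e :: real assume "e > 0"
    then obtain N where "4 / e\<^sup>2 < real N"
      using reals_Archimedean2 by blast
    then have "4 < e\<^sup>2 * real (Suc N)"
      using \<open>e > 0\<close> by (simp add: divide_simps algebra_simps) (smt (verit) zero_less_power)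
    then have N: "4 / real (Suc N) < e\<^sup>2"
      by (simp add: divide_simps)
    have "dist (w k) (w n) < e" if "N \<le> k" "N \<le> n" for k n
      using close[OF that] N \<open>e > 0\<close> unfolding dist_norm
      by (intro power2_less_imp_less[of _ e]) auto
    then show "\<exists>N. \<forall>k\<ge>N. \<forall>n\<ge>N. dist (w k) (w n) < e"
      by blast
  qed
  then obtain x where x: "w \<longlonglongrightarrow> x"
    using Cauchy_convergent_iff convergent_def by blast
  have eps: "(\<lambda>n. 1 / real (Suc n)) \<longlonglongrightarrow> 0"
    using LIMSEQ_inverse_real_of_nat by (simp add: inverse_eq_divide)
  have "(norm x)\<^sup>2 + m \<le> 2 * (x \<bullet> v) + d" if vd: "(v, d) \<in> K" for v d
  proof -
    \<comment> \<open>Moving from the limit towards \<open>(v, d)\<close> cannot go below the infimum.  Almost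
      minimality bounds \<open>c n\<close> above in terms of \<open>w n\<close>, whose limit is known.
      The inequality is already divided by \<open>t\<close>, ready for \<open>t\<close> to tend to \<open>0\<close>.\<close>
    have step: "i + (norm x)\<^sup>2 \<le> 2 * (x \<bullet> v) + d + t * ((norm x)\<^sup>2 + (norm v)\<^sup>2 - 2 * (x \<bullet> v))"
      if t: "0 < t" "t < 1" for t
    proof -
      have "i \<le> (norm ((1 - t) *\<^sub>R w n + t *\<^sub>R v))\<^sup>2
              + (1 - t) * (i + 1 / real (Suc n) - (norm (w n))\<^sup>2) + t * d" for n
      proof -
        have "(1 - t) *\<^sub>R (w n, c n) + t *\<^sub>R (v, d) \<in> K"
          by (rule convexD[OF conv wcK vd]) (use t in auto)
        then have "i \<le> (norm ((1 - t) *\<^sub>R w n + t *\<^sub>R v))\<^sup>2 + ((1 - t) * c n + t * d)"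
          using i_le by simp
        moreover have "(1 - t) * c n \<le> (1 - t) * (i + 1 / real (Suc n) - (norm (w n))\<^sup>2)"
          using wc_less[of n] t by (intro mult_left_mono) auto
        ultimately show ?thesis by linarith
      qed
      moreover have "(\<lambda>n. (norm ((1 - t) *\<^sub>R w n + t *\<^sub>R v))\<^sup>2
              + (1 - t) * (i + 1 / real (Suc n) - (norm (w n))\<^sup>2) + t * d)
          \<longlonglongrightarrow> (norm ((1 - t) *\<^sub>R x + t *\<^sub>R v))\<^sup>2 + (1 - t) * (i + 0 - (norm x)\<^sup>2) + t * d"
        by (intro tendsto_intros x eps)
      ultimately have "i \<le> (norm ((1 - t) *\<^sub>R x + t *\<^sub>R v))\<^sup>2 + (1 - t) * (i + 0 - (norm x)\<^sup>2) + t * d"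
        by (intro LIMSEQ_le_const) auto
      also have "\<dots> = i + t * (2 * (x \<bullet> v) + d + t * ((norm x)\<^sup>2 + (norm v)\<^sup>2 - 2 * (x \<bullet> v))
                               - i - (norm x)\<^sup>2)"
        unfolding power2_norm_eq_inner
        by (simp add: inner_commute algebra_simps power2_eq_square)
      finally show ?thesis
        using t by (simp add: zero_le_mult_iff)
    qed
    have "((\<lambda>t. 2 * (x \<bullet> v) + d + t * ((norm x)\<^sup>2 + (norm v)\<^sup>2 - 2 * (x \<bullet> v)))
           \<longlongrightarrow> 2 * (x \<bullet> v) + d + 0 * ((norm x)\<^sup>2 + (norm v)\<^sup>2 - 2 * (x \<bullet> v))) (at_right 0)"
      by (intro tendsto_intros)
    moreover have "eventually (\<lambda>t. i + (norm x)\<^sup>2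
        \<le> 2 * (x \<bullet> v) + d + t * ((norm x)\<^sup>2 + (norm v)\<^sup>2 - 2 * (x \<bullet> v))) (at_right 0)"
      by (rule eventually_mono[OF eventually_at_right_real[of 0 1]]) (auto intro: step)
    ultimately have "i + (norm x)\<^sup>2 \<le> 2 * (x \<bullet> v) + d"
      using tendsto_lowerbound[OF _ _ trivial_limit_at_right_real] by fastforce
    then show ?thesis using m_le by linarith
  qed
  then show ?thesis by blast
qed auto

section \<open>Adjoints of bounded operators\<close>

text \<open>On the graph of \<open>-2 f\<close>, completing the square bounds \<open>\<parallel>w\<parallel>\<^sup>2 - 2 f w\<close> below by \<open>- \<parallel>f\<parallel>\<^sup>2\<close>.
  The minorant then makes the linear functional \<open>v \<mapsto> x \<bullet> v - f v\<close> bounded below on the whole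
  space, which forces it to vanish.\<close>

lemma riesz_representation:
  fixes f :: "'a::{real_inner,complete_space} \<Rightarrow> real"
  assumes "bounded_linear f"
  shows "\<exists>x. \<forall>v. f v = x \<bullet> v"
proof -
  interpret f: bounded_linear f by fact
  define K where "K = range (\<lambda>v. (v, - 2 * f v))"
  have "linear (\<lambda>v. (v, - 2 * f v))"
    by (rule linearI) (auto simp: f.add f.scaleR algebra_simps)
  then have "convex K"
    unfolding K_def by (intro convex_linear_image) auto
  moreover have "- (onorm f)\<^sup>2 \<le> (norm w)\<^sup>2 + c" if "(w, c) \<in> K" for w c
  proof -
    have "f w \<le> onorm f * norm w"
      using onorm[OF assms, of w] by simp
    moreover have "0 \<le> (norm w - onorm f)\<^sup>2" by simp
    ultimately show ?thesis
      using that by (auto simp: K_def power2_diff algebra_simps)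
  qed
  ultimately obtain x where x: "\<And>w c. (w, c) \<in> K \<Longrightarrow> (norm x)\<^sup>2 - (onorm f)\<^sup>2 \<le> 2 * (x \<bullet> w) + c"
    using convex_strongly_convex_minorant[of K "- (onorm f)\<^sup>2"] by force
  define b where "b = ((norm x)\<^sup>2 - (onorm f)\<^sup>2) / 2"
  have b: "b \<le> x \<bullet> v - f v" for v
    using x[of v "- 2 * f v"] by (auto simp: K_def b_def)
  have "f v = x \<bullet> v" for v
  proof (rule ccontr)
    assume "f v \<noteq> x \<bullet> v"
    then have s: "x \<bullet> v - f v \<noteq> 0" by simp
    \<comment> \<open>a multiple of \<open>v\<close> at which the affine function takes the value \<open>b - 1\<close>\<close>
    define t where "t = (b - 1) / (x \<bullet> v - f v)"
    have "x \<bullet> (t *\<^sub>R v) - f (t *\<^sub>R v) = t * (x \<bullet> v - f v)"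
      by (simp add: f.scaleR algebra_simps)
    also have "\<dots> = b - 1" using s by (simp add: t_def)
    finally show False using b[of "t *\<^sub>R v"] by simp
  qed
  then show ?thesis by blast
qed

lemma adjoint_works_hilbert:
  fixes C :: "'a::{real_inner,complete_space} \<Rightarrow> 'b::real_inner"
  assumes "bounded_linear C"
  shows "x \<bullet> adjoint C y = C x \<bullet> y"
proof -
  have "\<exists>z. \<forall>x. C x \<bullet> y = z \<bullet> x" for y
    by (rule riesz_representation)
      (rule bounded_linear_compose[OF bounded_linear_inner_left assms])
  then have "\<exists>g. \<forall>x y. C x \<bullet> y = x \<bullet> g y"
    by (metis inner_commute)
  then have "\<forall>x y. C x \<bullet> y = x \<bullet> adjoint C y"
    unfolding adjoint_def by (rule someI_ex)
  then show ?thesis by simp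
qed

lemma adjoint_diff_hilbert:
  fixes C :: "'a::{real_inner,complete_space} \<Rightarrow> 'b::real_inner"
  assumes "bounded_linear C"
  shows "adjoint C u - adjoint C v = adjoint C (u - v)"
proof -
  have "x \<bullet> (adjoint C u - adjoint C v) = x \<bullet> adjoint C (u - v)" for x
    by (simp add: inner_diff_right adjoint_works_hilbert[OF assms])
  then show ?thesis
    by (metis vector_eq_ldot)
qed

text \<open>The inequality behind both norm estimates; \<open>C = 0\<close> is covered because then
  \<open>a * \<parallel>C\<parallel>\<^sup>2 = 0\<close>.\<close>

lemma onorm_bound_scaled:
  assumes "bounded_linear C" and "a * (onorm C)\<^sup>2 \<le> 2"
  shows "a * (norm (C x))\<^sup>2 \<le> 2 * (norm x)\<^sup>2"
proof (cases "0 \<le> a")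
  case True
  have "(norm (C x))\<^sup>2 \<le> (onorm C * norm x)\<^sup>2"
    by (intro power_mono onorm assms norm_ge_zero)
  then have "a * (norm (C x))\<^sup>2 \<le> a * ((onorm C)\<^sup>2 * (norm x)\<^sup>2)"
    using True by (intro mult_left_mono) (simp_all add: power_mult_distrib)
  also have "\<dots> \<le> 2 * (norm x)\<^sup>2"
    using mult_right_mono[OF assms(2), of "(norm x)\<^sup>2"] by (simp add: mult.assoc)
  finally show ?thesis .
next
  case False
  then have "a * (norm (C x))\<^sup>2 \<le> 0"
    by (intro mult_nonpos_nonneg) auto
  then show ?thesis
    by (smt (verit) zero_le_power2)
qed

lemma onorm_id_minus_scaled_comp_adjoint_le:
  fixes C :: "'a::{real_inner,complete_space} \<Rightarrow> 'b::real_inner"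
  assumes C: "bounded_linear C" and a: "0 \<le> a" "a * (onorm C)\<^sup>2 \<le> 2"
  shows "onorm (\<lambda>v. v - a *\<^sub>R C (adjoint C v)) \<le> 1"
proof (rule onorm_bound)
  fix v :: 'b
  let ?w = "adjoint C v"
  have "(norm (v - a *\<^sub>R C ?w))\<^sup>2 = (norm v)\<^sup>2 - 2 * a * (norm ?w)\<^sup>2 + a * (a * (norm (C ?w))\<^sup>2)"
    using adjoint_works_hilbert[OF C, of ?w v] unfolding power2_norm_eq_inner
    by (simp add: inner_commute algebra_simps)
  also have "\<dots> \<le> (norm v)\<^sup>2"
    using mult_left_mono[OF onorm_bound_scaled[OF C a(2), of ?w] a(1)] by simp
  finally show "norm (v - a *\<^sub>R C ?w) \<le> 1 * norm v"
    by (auto intro: power2_le_imp_le)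
qed simp

section \<open>Minty's theorem\<close>

text \<open>The points \<open>(Y, V, c)\<close> of the convex hull of the triples \<open>(a, v, v \<bullet> a)\<close> satisfy
  \<open>c \<ge> V \<bullet> Y\<close>: monotonicity says that the symmetric form \<open>c + c' - V \<bullet> Y' - V' \<bullet> Y\<close> is nonnegative
  on pairs of triples, and as it is affine in each argument it stays so on pairs from the hull;
  on the diagonal this is the claim.  Hence \<open>\<parallel>(Y - V) / 2\<parallel>\<^sup>2 + c \<ge> \<parallel>(Y + V) / 2\<parallel>\<^sup>2 \<ge> 0\<close>.\<close>

lemma monotone_graph_hull_inner_le:
  fixes G :: "('a::real_inner \<times> 'a) set"
  assumes mono: "\<And>a v b w. (a, v) \<in> G \<Longrightarrow> (b, w) \<in> G \<Longrightarrow> 0 \<le> (v - w) \<bullet> (a - b)"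
    and hull: "(Y, V, c) \<in> convex hull ((\<lambda>(a, v). (a, v, v \<bullet> a)) ` G)"
  shows "V \<bullet> Y \<le> c"
proof -
  let ?S = "(\<lambda>(a, v). (a, v, v \<bullet> a)) ` G"
  let ?H = "\<lambda>(a, v, r). {(b::'a, w::'a, s::real). 0 \<le> r + s - v \<bullet> b - w \<bullet> a}"
  have half: "convex (?H q)" for q
  proof -
    obtain a v r where q: "q = (a, v, r)" by (cases q)
    have "?H q = {p. inner (- v, - a, 1) p \<ge> - r}"
      by (auto simp: q inner_prod_def inner_commute)
    then show ?thesis by (simp only: convex_halfspace_ge)
  qed
  have SS: "?S \<subseteq> ?H q" if "q \<in> ?S" for q
    using that mono by (force simp: inner_commute algebra_simps)
  have HS: "convex hull ?S \<subseteq> ?H q" if "q \<in> ?S" for q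
    by (rule hull_minimal) (rule SS[OF that], rule half)
  have "?S \<subseteq> ?H (Y, V, c)"
    using HS hull by (fastforce simp: algebra_simps)
  then have "convex hull ?S \<subseteq> ?H (Y, V, c)"
    by (rule hull_minimal) (rule half)
  then show ?thesis using hull by auto
qed

text \<open>Expanding \<open>(v + x) \<bullet> (a - x) \<ge> 0\<close> gives \<open>\<parallel>x\<parallel>\<^sup>2 \<le> x \<bullet> (a - v) + v \<bullet> a\<close>, which is the
  minorant at the pair \<open>((a - v) / 2, v \<bullet> a)\<close> with \<open>m = 0\<close>.  The factor \<open>1 / 2\<close> below is dictated
  by this match.\<close>

lemma monotone_graph_extension_point:
  fixes G :: "('a::{real_inner,complete_space} \<times> 'a) set"
  assumes mono: "\<And>a v b w. (a, v) \<in> G \<Longrightarrow> (b, w) \<in> G \<Longrightarrow> 0 \<le> (v - w) \<bullet> (a - b)"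
  shows "\<exists>x. \<forall>(a, v)\<in>G. 0 \<le> (v + x) \<bullet> (a - x)"
proof -
  let ?S = "(\<lambda>(a, v). (a, v, v \<bullet> a)) ` G"
  let ?L = "\<lambda>(a::'a, v::'a, c::real). ((1/2) *\<^sub>R (a - v), c)"
  define K where "K = ?L ` (convex hull ?S)"
  have "linear ?L"
    by (rule linearI) (auto simp: algebra_simps)
  then have "convex K"
    unfolding K_def by (intro convex_linear_image convex_convex_hull)
  moreover have "0 \<le> (norm w)\<^sup>2 + c" if "(w, c) \<in> K" for w c
  proof -
    from that obtain a v where "(a, v, c) \<in> convex hull ?S" and w: "w = (1/2) *\<^sub>R (a - v)"
      by (auto simp: K_def)
    then have "v \<bullet> a \<le> c"
      using monotone_graph_hull_inner_le[OF mono] by blast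
    moreover have "(norm w)\<^sup>2 + v \<bullet> a = (norm ((1/2) *\<^sub>R (a + v)))\<^sup>2"
      unfolding power2_norm_eq_inner w by (simp add: inner_commute algebra_simps)
    ultimately show ?thesis
      by (smt (verit) zero_le_power2)
  qed
  ultimately obtain x where x: "\<And>w c. (w, c) \<in> K \<Longrightarrow> (norm x)\<^sup>2 + 0 \<le> 2 * (x \<bullet> w) + c"
    using convex_strongly_convex_minorant[of K 0] by force
  have "0 \<le> (v + x) \<bullet> (a - x)" if "(a, v) \<in> G" for a v
  proof -
    have "(a, v, v \<bullet> a) \<in> convex hull ?S"
      using that by (intro hull_inc) force
    then have "((1/2) *\<^sub>R (a - v), v \<bullet> a) \<in> K"
      unfolding K_def by force
    from x[OF this] show ?thesis
      by (simp add: power2_norm_eq_inner inner_commute algebra_simps)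
  qed
  then show ?thesis by blast
qed

lemma maximal_monotone_memI:
  assumes "maximal_monotone A"
    and "\<And>a v. v \<in> A a \<Longrightarrow> 0 \<le> (v - w) \<bullet> (a - x)"
  shows "w \<in> A x"
proof -
  define B where "B = A(x := insert w (A x))"
  have sym: "0 \<le> (w - v) \<bullet> (x - a)" if "v \<in> A a" for a v
    using assms(2)[OF that] by (simp add: algebra_simps)
  have "monotone_operator B"
    using assms sym
    unfolding maximal_monotone_def monotone_operator_def B_def by auto
  moreover have "\<forall>z. A z \<subseteq> B z" by (auto simp: B_def)
  ultimately have "B = A"
    using assms(1) unfolding maximal_monotone_def by blast
  then show ?thesis by (metis B_def fun_upd_same insertI1)
qed

lemma mem_resolvent_op_scale_iff:
  "x \<in> resolvent (op_scale c A) z \<longleftrightarrow> (\<exists>v\<in>A x. z = x + c *\<^sub>R v)"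
  by (auto simp: resolvent_def op_inverse_def op_sum_def op_id_def op_scale_def)

lemma resolvent_firmly_nonexpansive:
  assumes "monotone_operator A" and "0 \<le> c"
    and "x \<in> resolvent (op_scale c A) z" and "x' \<in> resolvent (op_scale c A) z'"
  shows "(norm (x - x'))\<^sup>2 \<le> (x - x') \<bullet> (z - z')"
proof -
  obtain v v' where v: "v \<in> A x" "z = x + c *\<^sub>R v" and v': "v' \<in> A x'" "z' = x' + c *\<^sub>R v'"
    using assms(3,4) by (auto simp: mem_resolvent_op_scale_iff)
  have "0 \<le> c * ((v - v') \<bullet> (x - x'))"
    using assms v v' by (simp add: monotone_operator_def)
  also have "\<dots> = (x - x') \<bullet> (z - z') - (norm (x - x'))\<^sup>2"
    unfolding power2_norm_eq_inner v v' by (simp add: inner_commute algebra_simps)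
  finally show ?thesis by simp
qed

lemma resolvent_unique:
  assumes "monotone_operator A" and "0 \<le> c"
    and "x \<in> resolvent (op_scale c A) z" and "x' \<in> resolvent (op_scale c A) z"
  shows "x = x'"
  using resolvent_firmly_nonexpansive[OF assms] by simp

lemma resolvent_singleton:
  fixes A :: "'a::{real_inner,complete_space} \<Rightarrow> 'a set"
  assumes A: "maximal_monotone A" and c: "0 < c"
  shows "\<exists>x. resolvent (op_scale c A) z = {x}"
proof -
  have mono: "monotone_operator A" using A by (simp add: maximal_monotone_def)
  \<comment> \<open>the graph of \<open>c A - z\<close>, which turns \<open>z - x \<in> c A x\<close> into \<open>-x \<in> c A x - z\<close>\<close>
  define G where "G = {(a, c *\<^sub>R v - z) | a v. v \<in> A a}"
  have "0 \<le> (v - w) \<bullet> (a - b)" if "(a, v) \<in> G" "(b, w) \<in> G" for a v b w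
  proof -
    from that obtain v' w' where *: "v' \<in> A a" "w' \<in> A b" "v = c *\<^sub>R v' - z" "w = c *\<^sub>R w' - z"
      by (auto simp: G_def)
    have "v - w = c *\<^sub>R (v' - w')" by (simp add: * algebra_simps)
    moreover have "0 \<le> (v' - w') \<bullet> (a - b)"
      using mono * unfolding monotone_operator_def by blast
    ultimately show ?thesis using c by simp
  qed
  then obtain x where x: "\<And>a v. (a, v) \<in> G \<Longrightarrow> 0 \<le> (v + x) \<bullet> (a - x)"
    using monotone_graph_extension_point[of G] by blast
  define w where "w = (1 / c) *\<^sub>R (z - x)"
  have "w \<in> A x"
  proof (rule maximal_monotone_memI[OF A])
    fix a v assume "v \<in> A a"
    then have "0 \<le> (c *\<^sub>R v - z + x) \<bullet> (a - x)"
      by (intro x) (auto simp: G_def)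
    also have "c *\<^sub>R v - z + x = c *\<^sub>R (v - w)"
      using c by (simp add: w_def algebra_simps)
    finally show "0 \<le> (v - w) \<bullet> (a - x)"
      using c by (simp add: zero_le_mult_iff)
  qed
  then have "x \<in> resolvent (op_scale c A) z"
    using c by (auto simp: mem_resolvent_op_scale_iff w_def intro!: bexI[of _ w])
  then show ?thesis
    using resolvent_unique[OF mono] c by (metis is_singletonI' is_singleton_def empty_iff less_imp_le)
qed

lemma resolvent_fun_eq_iff:
  fixes A :: "'a::{real_inner,complete_space} \<Rightarrow> 'a set"
  assumes "maximal_monotone A" and "0 < c"
  shows "resolvent_fun (op_scale c A) z = x \<longleftrightarrow> (\<exists>v\<in>A x. z = x + c *\<^sub>R v)"
proof -
  obtain x' where "resolvent (op_scale c A) z = {x'}"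
    using resolvent_singleton[OF assms] by blast
  then show ?thesis
    unfolding mem_resolvent_op_scale_iff[symmetric] resolvent_fun_def by auto
qed

lemma resolvent_fun_firmly_nonexpansive:
  fixes A :: "'a::{real_inner,complete_space} \<Rightarrow> 'a set"
  assumes "maximal_monotone A" and "0 < c"
  shows "(norm (resolvent_fun (op_scale c A) z - resolvent_fun (op_scale c A) z'))\<^sup>2
    \<le> (resolvent_fun (op_scale c A) z - resolvent_fun (op_scale c A) z') \<bullet> (z - z')"
proof (rule resolvent_firmly_nonexpansive)
  show "resolvent_fun (op_scale c A) z \<in> resolvent (op_scale c A) z"
    "resolvent_fun (op_scale c A) z' \<in> resolvent (op_scale c A) z'"
    unfolding mem_resolvent_op_scale_iff resolvent_fun_eq_iff[OF assms, symmetric] by (rule refl)+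
qed (use assms in \<open>auto simp: maximal_monotone_def\<close>)

section \<open>The Yosida approximation and the fixed point map\<close>

text \<open>The shift \<open>\<kappa> u\<close> cancels the denominator of the Yosida approximation, leaving
  \<open>J\<^bsub>\<kappa> M\<^esub> (s + \<kappa> u) = s\<close>.\<close>

lemma yosida_fixed_iff:
  fixes M :: "'a::{real_inner,complete_space} \<Rightarrow> 'a set"
  assumes "maximal_monotone M" and "0 < \<kappa>"
  shows "u = yosida M \<kappa> (s + \<kappa> *\<^sub>R u) \<longleftrightarrow> u \<in> M s"
proof -
  let ?J = "resolvent_fun (op_scale \<kappa> M) (s + \<kappa> *\<^sub>R u)"
  have "u = yosida M \<kappa> (s + \<kappa> *\<^sub>R u) \<longleftrightarrow> \<kappa> *\<^sub>R u = s + \<kappa> *\<^sub>R u - ?J"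
    using assms(2) real_vector_eq_affinity[of \<kappa> "s + \<kappa> *\<^sub>R u - ?J" u 0]
    by (auto simp: yosida_def inverse_eq_divide)
  also have "\<dots> \<longleftrightarrow> ?J = s"
    by (auto simp: algebra_simps)
  also have "\<dots> \<longleftrightarrow> u \<in> M s"
    using assms(2) by (auto simp: resolvent_fun_eq_iff[OF assms])
  finally show ?thesis .
qed

text \<open>With \<open>J\<close>, also \<open>I - J\<close> is firmly nonexpansive and therefore nonexpansive.\<close>

lemma norm_yosida_diff_le:
  fixes M :: "'a::{real_inner,complete_space} \<Rightarrow> 'a set"
  assumes "maximal_monotone M" and "0 < \<kappa>"
  shows "norm (yosida M \<kappa> z - yosida M \<kappa> z') \<le> (1 / \<kappa>) * norm (z - z')"
proof -
  define q where "q = resolvent_fun (op_scale \<kappa> M) z - resolvent_fun (op_scale \<kappa> M) z'"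
  have "(norm q)\<^sup>2 \<le> q \<bullet> (z - z')"
    unfolding q_def by (rule resolvent_fun_firmly_nonexpansive[OF assms])
  moreover have "(norm (z - z' - q))\<^sup>2 = (norm (z - z'))\<^sup>2 - 2 * (q \<bullet> (z - z')) + (norm q)\<^sup>2"
    unfolding power2_norm_eq_inner by (simp add: inner_commute algebra_simps)
  ultimately have "(norm (z - z' - q))\<^sup>2 \<le> (norm (z - z'))\<^sup>2"
    using zero_le_power2[of "norm q"] by linarith
  then have "norm (z - z' - q) \<le> norm (z - z')"
    by (rule power2_le_imp_le) simp
  moreover have "yosida M \<kappa> z - yosida M \<kappa> z' = (1 / \<kappa>) *\<^sub>R (z - z' - q)"
    by (simp add: yosida_def q_def algebra_simps)
  ultimately show ?thesis
    using assms(2) by (simp add: divide_right_mono)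
qed

text \<open>Membership in \<open>M2 (C x)\<close> is the same condition for every index \<open>\<kappa>\<close>, so all these maps
  share their fixed points.\<close>

lemma fixpoint_map_fixed_iff:
  fixes C :: "'a::{real_inner,complete_space} \<Rightarrow> 'b::{real_inner,complete_space}"
  assumes "maximal_monotone M2" and "0 < \<kappa>"
  shows "u = fixpoint_map C M1 M2 lam y \<kappa> u \<longleftrightarrow>
    u \<in> M2 (C (resolvent_fun (op_scale lam M1) (y - lam *\<^sub>R adjoint C u)))"
  unfolding fixpoint_map_def by (rule yosida_fixed_iff[OF assms])

lemma monotone_operator_op_sum:
  assumes "monotone_operator A" and "monotone_operator B"
  shows "monotone_operator (op_sum A B)"
proof -
  have "0 \<le> (a + b - (a' + b')) \<bullet> (x - x')"
    if "a \<in> A x" "b \<in> B x" "a' \<in> A x'" "b' \<in> B x'" for a b a' b' x x'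
  proof -
    have "0 \<le> (a - a') \<bullet> (x - x')" "0 \<le> (b - b') \<bullet> (x - x')"
      using assms that unfolding monotone_operator_def by blast+
    then show ?thesis by (simp add: inner_simps)
  qed
  then show ?thesis
    unfolding monotone_operator_def op_sum_def by blast
qed

lemma monotone_operator_adjoint_comp:
  fixes C :: "'a::{real_inner,complete_space} \<Rightarrow> 'b::real_inner"
  assumes C: "bounded_linear C" and M: "monotone_operator M"
  shows "monotone_operator (adjoint_comp C M)"
proof -
  interpret C: bounded_linear C by fact
  have "0 \<le> (adjoint C u - adjoint C v) \<bullet> (x - x')" if "u \<in> M (C x)" "v \<in> M (C x')" for u v x x'
  proof -
    have "(x - x') \<bullet> adjoint C (u - v) = (C x - C x') \<bullet> (u - v)"
      by (simp add: adjoint_works_hilbert[OF C] C.diff)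
    then have "(adjoint C u - adjoint C v) \<bullet> (x - x') = (u - v) \<bullet> (C x - C x')"
      by (simp only: adjoint_diff_hilbert[OF C] inner_commute)
    then show ?thesis using M that by (simp add: monotone_operator_def)
  qed
  then show ?thesis
    unfolding monotone_operator_def adjoint_comp_def by blast
qed

lemma mem_resolvent_sum_iff:
  fixes C :: "'a::{real_inner,complete_space} \<Rightarrow> 'b::real_inner"
  assumes "maximal_monotone M1" and "0 < lam"
  shows "x \<in> resolvent (op_scale lam (op_sum M1 (adjoint_comp C M2))) y \<longleftrightarrow>
    (\<exists>u\<in>M2 (C x). x = resolvent_fun (op_scale lam M1) (y - lam *\<^sub>R adjoint C u))"
proof -
  have "x \<in> resolvent (op_scale lam (op_sum M1 (adjoint_comp C M2))) y \<longleftrightarrow>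
      (\<exists>u\<in>M2 (C x). \<exists>v\<in>M1 x. y = x + lam *\<^sub>R (v + adjoint C u))"
    by (auto simp: mem_resolvent_op_scale_iff op_sum_def adjoint_comp_def)
  also have "\<dots> \<longleftrightarrow> (\<exists>u\<in>M2 (C x). resolvent_fun (op_scale lam M1) (y - lam *\<^sub>R adjoint C u) = x)"
    by (simp add: resolvent_fun_eq_iff[OF assms] algebra_simps)
  finally show ?thesis by (auto simp: eq_commute)
qed

text \<open>A triangle inequality for the increment \<open>C p + \<kappa> d\<close> of the argument of the Yosida approximation
  would lose the sign of \<open>C p \<bullet> d\<close>.  Firm nonexpansiveness of the resolvent makes this cross term
  negative enough to pay for \<open>\<parallel>C p\<parallel>\<^sup>2\<close>.\<close>

lemma fixpoint_map_nonexpansive: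
  fixes C :: "'a::{real_inner,complete_space} \<Rightarrow> 'b::{real_inner,complete_space}"
  assumes C: "bounded_linear C" and M1: "maximal_monotone M1" and M2: "maximal_monotone M2"
    and lam: "0 < lam" and \<kappa>: "0 < \<kappa>" and le: "lam / \<kappa> * (onorm C)\<^sup>2 \<le> 2"
  shows "1-lipschitz_on UNIV (fixpoint_map C M1 M2 lam y \<kappa>)"
proof (rule lipschitz_onI)
  interpret C: bounded_linear C by fact
  fix u v :: 'b
  define J where "J u = resolvent_fun (op_scale lam M1) (y - lam *\<^sub>R adjoint C u)" for u
  define p where "p = J u - J v"
  define d where "d = u - v"
  have "(norm p)\<^sup>2 \<le> p \<bullet> ((y - lam *\<^sub>R adjoint C u) - (y - lam *\<^sub>R adjoint C v))"
    unfolding p_def J_def by (rule resolvent_fun_firmly_nonexpansive[OF M1 lam])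
  also have "(y - lam *\<^sub>R adjoint C u) - (y - lam *\<^sub>R adjoint C v) = - lam *\<^sub>R adjoint C d"
    by (simp add: d_def adjoint_diff_hilbert[OF C, symmetric] algebra_simps)
  also have "p \<bullet> (- lam *\<^sub>R adjoint C d) = - lam * (C p \<bullet> d)"
    by (simp add: adjoint_works_hilbert[OF C])
  finally have firm: "(norm p)\<^sup>2 \<le> - lam * (C p \<bullet> d)" .
  have "lam / \<kappa> * (norm (C p))\<^sup>2 \<le> 2 * (norm p)\<^sup>2"
    by (rule onorm_bound_scaled[OF C le])
  also have "\<dots> \<le> 2 * (- lam * (C p \<bullet> d))" using firm by simp
  finally have "lam * ((norm (C p))\<^sup>2 + 2 * \<kappa> * (C p \<bullet> d)) \<le> 0"
    using \<kappa> by (simp add: field_simps)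
  then have "(norm (C p))\<^sup>2 + 2 * \<kappa> * (C p \<bullet> d) \<le> 0"
    using lam by (simp add: mult_le_0_iff)
  moreover have "(norm (C p + \<kappa> *\<^sub>R d))\<^sup>2
      = (norm (C p))\<^sup>2 + 2 * \<kappa> * (C p \<bullet> d) + (\<kappa> * norm d)\<^sup>2"
    unfolding power_mult_distrib power2_norm_eq_inner
    by (simp add: inner_commute algebra_simps power2_eq_square)
  ultimately have "(norm (C p + \<kappa> *\<^sub>R d))\<^sup>2 \<le> (\<kappa> * norm d)\<^sup>2" by simp
  then have sq: "norm (C p + \<kappa> *\<^sub>R d) \<le> \<kappa> * norm d"
    by (rule power2_le_imp_le) (use \<kappa> in simp)
  have "norm (fixpoint_map C M1 M2 lam y \<kappa> u - fixpoint_map C M1 M2 lam y \<kappa> v)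
      \<le> (1 / \<kappa>) * norm ((C (J u) + \<kappa> *\<^sub>R u) - (C (J v) + \<kappa> *\<^sub>R v))"
    unfolding fixpoint_map_def J_def by (rule norm_yosida_diff_le[OF M2 \<kappa>])
  also have "(C (J u) + \<kappa> *\<^sub>R u) - (C (J v) + \<kappa> *\<^sub>R v) = C p + \<kappa> *\<^sub>R d"
    by (simp add: p_def d_def C.diff algebra_simps)
  also have "(1 / \<kappa>) * norm (C p + \<kappa> *\<^sub>R d) \<le> norm d"
    using sq \<kappa> by (simp add: field_simps)
  finally show "dist (fixpoint_map C M1 M2 lam y \<kappa> u) (fixpoint_map C M1 M2 lam y \<kappa> v) \<le> 1 * dist u v"
    by (simp add: dist_norm d_def)
qed simp

theorem theorem10:
  fixes C :: "'a::{real_inner,complete_space} \<Rightarrow> 'b::{real_inner,complete_space}"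
    and M1 :: "'a \<Rightarrow> 'a set"
    and M2 :: "'b \<Rightarrow> 'b set"
    and lam :: real
    and y :: 'a
  assumes "bounded_linear C"
    and "maximal_monotone M1"
    and "maximal_monotone M2"
    and "lam > 0"
  shows
    \<comment> \<open>First the point-valued resolvents are well defined. The identity then has two halves, because
      the resolvent of the sum may be empty at \<open>y\<close> and a fixed point need not be unique. The bound
      \<open>2 / \<parallel>C\<parallel>\<^sup>2\<close> is read as infinite when \<open>C = 0\<close>.\<close>
    "((\<forall>z. \<exists>x. resolvent (op_scale lam M1) z = {x}) \<and>
      (\<forall>\<kappa>>0. \<forall>z. \<exists>x. resolvent (op_scale \<kappa> M2) z = {x})) \<and>
     (\<forall>\<kappa>>0. \<forall>u. u = fixpoint_map C M1 M2 lam y \<kappa> u \<longrightarrow>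
        resolvent (op_scale lam (op_sum M1 (adjoint_comp C M2))) y =
          {resolvent_fun (op_scale lam M1) (y - lam *\<^sub>R adjoint C u)}) \<and>
     (\<forall>x. x \<in> resolvent (op_scale lam (op_sum M1 (adjoint_comp C M2))) y \<longrightarrow>
        (\<exists>u. x = resolvent_fun (op_scale lam M1) (y - lam *\<^sub>R adjoint C u) \<and>
             (\<forall>\<kappa>>0. u = fixpoint_map C M1 M2 lam y \<kappa> u))) \<and>
     (\<forall>\<kappa>>0. (onorm C = 0 \<or> lam / \<kappa> \<le> 2 / (onorm C)\<^sup>2) \<longrightarrow>
        onorm (\<lambda>v. v - (lam / \<kappa>) *\<^sub>R C (adjoint C v)) \<le> 1 \<and>
        1-lipschitz_on UNIV (fixpoint_map C M1 M2 lam y \<kappa>))"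
proof (intro conjI allI impI)
  have mono: "monotone_operator (op_sum M1 (adjoint_comp C M2))"
    using assms by (intro monotone_operator_op_sum monotone_operator_adjoint_comp)
      (auto simp: maximal_monotone_def)
  note unique = resolvent_unique[OF mono less_imp_le[OF assms(4)]]
  show "\<exists>x. resolvent (op_scale lam M1) z = {x}" for z
    by (rule resolvent_singleton[OF assms(2,4)])
  show "\<exists>x. resolvent (op_scale \<kappa> M2) z = {x}" if "\<kappa> > 0" for \<kappa> z
    by (rule resolvent_singleton[OF assms(3) that])
  show "resolvent (op_scale lam (op_sum M1 (adjoint_comp C M2))) y =
      {resolvent_fun (op_scale lam M1) (y - lam *\<^sub>R adjoint C u)}"
    if "\<kappa> > 0" "u = fixpoint_map C M1 M2 lam y \<kappa> u" for \<kappa> u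
  proof -
    have "resolvent_fun (op_scale lam M1) (y - lam *\<^sub>R adjoint C u)
        \<in> resolvent (op_scale lam (op_sum M1 (adjoint_comp C M2))) y"
      using that fixpoint_map_fixed_iff[OF assms(3) that(1), of u C M1 lam y]
      by (auto simp: mem_resolvent_sum_iff[OF assms(2,4)])
    then show ?thesis using unique by blast
  qed
  show "\<exists>u. x = resolvent_fun (op_scale lam M1) (y - lam *\<^sub>R adjoint C u) \<and>
      (\<forall>\<kappa>>0. u = fixpoint_map C M1 M2 lam y \<kappa> u)"
    if "x \<in> resolvent (op_scale lam (op_sum M1 (adjoint_comp C M2))) y" for x
    using that fixpoint_map_fixed_iff[OF assms(3), of _ _ C M1 lam y]
    unfolding mem_resolvent_sum_iff[OF assms(2,4)] by metis
  fix \<kappa> :: real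
  assume \<kappa>: "\<kappa> > 0" and "onorm C = 0 \<or> lam / \<kappa> \<le> 2 / (onorm C)\<^sup>2"
  then have le: "lam / \<kappa> * (onorm C)\<^sup>2 \<le> 2"
    by (cases "onorm C = 0") (auto simp: pos_le_divide_eq)
  show "onorm (\<lambda>v. v - (lam / \<kappa>) *\<^sub>R C (adjoint C v)) \<le> 1"
    using \<kappa> assms(4) by (intro onorm_id_minus_scaled_comp_adjoint_le[OF assms(1) _ le]) simp
  show "1-lipschitz_on UNIV (fixpoint_map C M1 M2 lam y \<kappa>)"
    by (rule fixpoint_map_nonexpansive[OF assms \<kappa> le])
qed

end
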